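(* Let $B$ be a truss endowed with a descending filtration $B=\bigcup_{i\ge1}B_i$, where each $B_i$ is an ideal of $B$, $B_{i+1}\subset B_i$, $B_i*B_j\subset B_{i+j}$ for all $i,j\ge1$, $\bigcap_{i=1}^{\infty}B_i=0$, and such that $\deg\alpha(a)>2$ for all $a\in B$. Then the associated graded structure $B_{gr}=\bigoplus_{i\ge1}B_i/B_{i+1}$, with the multiplication induced by $*$, is a pre-Lie algebra.
   Context: A truss is a set $B$ with two binary operations $\circ,+$ such that $(B,+)$ is an abelian group, $(B,\circ)$ is a semigroup, and $a\circ(b+c)+a=a\circ b+a\circ c+\alpha(a)$ for all $a,b,c$, where $\alpha:B\to B$ is some function. Put $a*b=a\circ b-a-b$; in terms of $*$ the axioms read $(a*b+a+b)*c=a*c+b*c+a*(b*c)$ and $a*(b+c)=a*b+a*c+\alpha(a)$. An ideal $I\triangleleft B$ is a subgroup of $(B,+)$ with $B*I\subseteq I$, $I*B\subseteq I$ such that the operations of $B$ pass to the quotient $B/I$. The degree of $x\in B$, $x\ne0$, is the $i$ with $x\in B_i$, $x\notin B_{i+1}$ (and $\deg 0=\infty$); thus $\deg\alpha(a)>2$ means $\alpha(a)\in B_3$. The multiplication on $B_{gr}$ is defined on homogeneous elements by $(a+B_{i+1})*(b+B_{j+1})=a*b+B_{i+j+1}$ for $a\in B_i$, $b\in B_j$, and extended biadditively (that this is well defined is part of the claim). A pre-Lie algebra is an abelian group with a biadditive product $\cdot$ whose associator $(a,b,c)=(a\cdot b)\cdot c-a\cdot(b\cdot c)$ satisfies $(a,b,c)=(b,a,c)$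 for all $a,b,c$. *)

theory Defs
  imports "HOL-Algebra.AbelCoset" "HOL-Algebra.Product_Groups" "HOL-Library.Extended_Nat"
begin

text \<open>
  A truss is carried by a \<open>ring\<close> record in which \<open>\<oplus>\<close> is the addition and \<open>\<otimes>\<close> is the
  circle operation; the \<open>one\<close> field is not constrained and plays no role.
\<close>

locale truss = abelian_group B for B (structure) +
  fixes \<alpha> :: "'a \<Rightarrow> 'a"
  assumes alpha_closed: "a \<in> carrier B \<Longrightarrow> \<alpha> a \<in> carrier B"
    and circ_closed: "\<lbrakk>a \<in> carrier B; b \<in> carrier B\<rbrakk> \<Longrightarrow> a \<otimes> b \<in> carrier B"
    and circ_assoc: "\<lbrakk>a \<in> carrier B; b \<in> carrier B; c \<in> carrier B\<rbrakk>
      \<Longrightarrow> (a \<otimes> b) \<otimes> c = a \<otimes> (b \<otimes> c)"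
    and circ_add: "\<lbrakk>a \<in> carrier B; b \<in> carrier B; c \<in> carrier B\<rbrakk>
      \<Longrightarrow> a \<otimes> (b \<oplus> c) \<oplus> a = (a \<otimes> b) \<oplus> (a \<otimes> c) \<oplus> \<alpha> a"

definition star :: "('a, 'm) ring_scheme \<Rightarrow> 'a \<Rightarrow> 'a \<Rightarrow> 'a"
  where "star B a b = (a \<otimes>\<^bsub>B\<^esub> b) \<ominus>\<^bsub>B\<^esub> a \<ominus>\<^bsub>B\<^esub> b"

text \<open>
  The last assumption says that the circle operation passes to the quotient; for the addition this
  is automatic, as the additive group is abelian.
\<close>

locale truss_ideal = additive_subgroup I B for I and B (structure) +
  assumes star_left: "\<lbrakk>b \<in> carrier B; x \<in> I\<rbrakk> \<Longrightarrow> star B b x \<in> I"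
    and star_right: "\<lbrakk>x \<in> I; b \<in> carrier B\<rbrakk> \<Longrightarrow> star B x b \<in> I"
    and circ_quotient: "\<lbrakk>a \<in> carrier B; a' \<in> carrier B; b \<in> carrier B; b' \<in> carrier B;
        I +> a = I +> a'; I +> b = I +> b'\<rbrakk> \<Longrightarrow> I +> (a \<otimes> b) = I +> (a' \<otimes> b')"

text \<open>
  For a descending filtration with trivial intersection and union the whole truss, the index below
  exists and is unique for every nonzero element.
\<close>

definition filt_degree :: "('a, 'm) ring_scheme \<Rightarrow> (nat \<Rightarrow> 'a set) \<Rightarrow> 'a \<Rightarrow> enat"
  where "filt_degree B Bs x =
    (if x = \<zero>\<^bsub>B\<^esub> then \<infinity> else enat (THE i. 1 \<le> i \<and> x \<in> Bs i \<and> x \<notin> Bs (Suc i)))"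

definition gr_comp :: "('a, 'm) ring_scheme \<Rightarrow> (nat \<Rightarrow> 'a set) \<Rightarrow> nat \<Rightarrow> 'a set monoid"
  where "gr_comp B Bs i = (add_monoid B)\<lparr>carrier := Bs i\<rparr> Mod Bs (Suc i)"

text \<open>
  Product of a coset in degree \<open>i\<close> with a coset in degree \<open>j\<close>. As with \<open>rcoset_mult\<close>, the union
  avoids choosing representatives: it is a single coset exactly when the result does not depend on
  them.
\<close>

definition gr_hom_mult ::
    "('a, 'm) ring_scheme \<Rightarrow> (nat \<Rightarrow> 'a set) \<Rightarrow> nat \<Rightarrow> nat \<Rightarrow> 'a set \<Rightarrow> 'a set \<Rightarrow> 'a set"
  where "gr_hom_mult B Bs i j P Q = (\<Union>a\<in>P. \<Union>b\<in>Q. Bs (Suc (i + j)) +>\<^bsub>B\<^esub> star B a b)"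

text \<open>
  Biadditive extension: the degree \<open>n\<close> component of a product is the sum over \<open>i + j = n\<close> with
  \<open>i, j \<ge> 1\<close> of the homogeneous products. The quotient groups are written multiplicatively, so this
  sum is a \<open>finprod\<close>.
\<close>

definition gr_mult ::
    "('a, 'm) ring_scheme \<Rightarrow> (nat \<Rightarrow> 'a set) \<Rightarrow> (nat \<Rightarrow> 'a set) \<Rightarrow> (nat \<Rightarrow> 'a set) \<Rightarrow> (nat \<Rightarrow> 'a set)"
  where "gr_mult B Bs x y = (\<lambda>n\<in>{1..}.
    finprod (gr_comp B Bs n) (\<lambda>i. gr_hom_mult B Bs i (n - i) (x i) (y (n - i))) {1..<n})"

text \<open>
  The additive group is the direct sum (finitely supported families) of the components.
  The \<open>one\<close> field of the record is a dummy: there is no unit.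
\<close>

definition assoc_graded :: "('a, 'm) ring_scheme \<Rightarrow> (nat \<Rightarrow> 'a set) \<Rightarrow> (nat \<Rightarrow> 'a set) ring"
  where "assoc_graded B Bs =
    \<lparr>carrier = carrier (sum_group {1..} (gr_comp B Bs)),
     monoid.mult = gr_mult B Bs,
     one = undefined,
     zero = one (sum_group {1..} (gr_comp B Bs)),
     add = monoid.mult (sum_group {1..} (gr_comp B Bs))\<rparr>"

definition gr_homog :: "('a, 'm) ring_scheme \<Rightarrow> (nat \<Rightarrow> 'a set) \<Rightarrow> nat \<Rightarrow> 'a set \<Rightarrow> (nat \<Rightarrow> 'a set)"
  where "gr_homog B Bs i P = (\<lambda>k\<in>{1..}. if k = i then P else \<one>\<^bsub>gr_comp B Bs k\<^esub>)"

definition associator :: "('a, 'm) ring_scheme \<Rightarrow> 'a \<Rightarrow> 'a \<Rightarrow> 'a \<Rightarrow> 'a"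
  where "associator L a b c = ((a \<otimes>\<^bsub>L\<^esub> b) \<otimes>\<^bsub>L\<^esub> c) \<ominus>\<^bsub>L\<^esub> (a \<otimes>\<^bsub>L\<^esub> (b \<otimes>\<^bsub>L\<^esub> c))"

locale pre_lie_algebra = abelian_group L for L (structure) +
  assumes prod_closed: "\<lbrakk>a \<in> carrier L; b \<in> carrier L\<rbrakk> \<Longrightarrow> a \<otimes> b \<in> carrier L"
    and prod_add_left: "\<lbrakk>a \<in> carrier L; b \<in> carrier L; c \<in> carrier L\<rbrakk>
      \<Longrightarrow> (a \<oplus> b) \<otimes> c = (a \<otimes> c) \<oplus> (b \<otimes> c)"
    and prod_add_right: "\<lbrakk>a \<in> carrier L; b \<in> carrier L; c \<in> carrier L\<rbrakk>
      \<Longrightarrow> a \<otimes> (b \<oplus> c) = (a \<otimes> b) \<oplus> (a \<otimes> c)"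
    and associator_sym: "\<lbrakk>a \<in> carrier L; b \<in> carrier L; c \<in> carrier L\<rbrakk>
      \<Longrightarrow> associator L a b c = associator L b a c"

end

theory Submission
  imports Defs
begin

text \<open>
  Since \<open>a * 0\<close> lies in every \<open>B\<^sub>n\<close>, it vanishes, and hence so does \<open>\<alpha> a = - (a * 0)\<close>. So \<open>*\<close> is additive
  on the right. Let \<open>E(a, b, c) = (a + b) * c - a * c - b * c\<close> measure the failure on the left.
  Evaluating \<open>(a \<circ> b) * c\<close> with \<open>a \<circ> b = (a + b) + a * b\<close> gives
  \<open>a * (b * c) = E(a, b, c) + (a * b) * c + E(a + b, a * b, c)\<close>.
  Replacing \<open>(a, b)\<close> by \<open>(a + b, a * b)\<close> raises the total degree, and modulo a fixed ideal \<open>B\<^sub>m\<close> the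
  defect vanishes once one of its first two arguments lies in \<open>B\<^sub>m\<close>; so by induction \<open>E(a, b, c)\<close> has
  degree at least \<open>i + j + k\<close> for \<open>a, b, c\<close> of degrees \<open>i, j, k\<close>. Therefore the product of the graded
  pieces is well defined and biadditive, and modulo \<open>B\<^bsub>i+j+k+1\<^esub>\<close> the associator of \<open>a, b, c\<close> is
  \<open>- E(a, b, c)\<close>, which is symmetric in \<open>a\<close> and \<open>b\<close>.
\<close>

text \<open>Symmetry of the associator is derived below as an equation between sums, where
  \<open>a_ac\<close> can normalise. This turns such an equation back into one between
  differences.\<close>

lemma (in abelian_group) minus_eq_minusI:
  assumes eq: "p \<oplus> s = r \<oplus> q"
    and carr: "p \<in> carrier G" "q \<in> carrier G" "r \<in> carrier G" "s \<in> carrier G"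
  shows "p \<ominus> q = r \<ominus> s"
proof -
  have "p \<ominus> q = (p \<oplus> s) \<oplus> (\<ominus> s \<oplus> \<ominus> q)"
    using carr by (simp add: a_minus_def a_assoc r_neg2)
  also have "\<dots> = r \<ominus> s"
    unfolding eq using carr by (simp add: a_minus_def a_assoc a_comm[of "\<ominus> s" "\<ominus> q"] r_neg2)
  finally show ?thesis .
qed

section \<open>Filtered trusses and the arithmetic of the filtration\<close>

locale filtered_truss = truss B \<alpha> for B (structure) and \<alpha> +
  fixes Bs :: "nat \<Rightarrow> 'a set"
  assumes filt_Un: "carrier B = (\<Union>i\<in>{1..}. Bs i)"
    and filt_ideal: "1 \<le> i \<Longrightarrow> truss_ideal (Bs i) B"
    and filt_Suc: "1 \<le> i \<Longrightarrow> Bs (Suc i) \<subseteq> Bs i"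
    and star_filt: "\<lbrakk>1 \<le> i; 1 \<le> j; a \<in> Bs i; b \<in> Bs j\<rbrakk> \<Longrightarrow> star B a b \<in> Bs (i + j)"
    and filt_Int: "(\<Inter>i\<in>{1..}. Bs i) = {\<zero>}"
begin

abbreviation star_B (infixl \<open>\<star>\<close> 71) where "a \<star> b \<equiv> star B a b"

lemma filt_subgroup: "1 \<le> i \<Longrightarrow> additive_subgroup (Bs i) B"
  by (rule truss_ideal.axioms(1)[OF filt_ideal])

lemma filt_carrier: "\<lbrakk>1 \<le> i; x \<in> Bs i\<rbrakk> \<Longrightarrow> x \<in> carrier B"
  using filt_Un by auto

lemma filt_zero: "1 \<le> i \<Longrightarrow> \<zero> \<in> Bs i"
  by (rule additive_subgroup.zero_closed[OF filt_subgroup])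

lemma filt_add: "\<lbrakk>1 \<le> i; x \<in> Bs i; y \<in> Bs i\<rbrakk> \<Longrightarrow> x \<oplus> y \<in> Bs i"
  by (rule additive_subgroup.a_closed[OF filt_subgroup])

lemma filt_minus: "\<lbrakk>1 \<le> i; x \<in> Bs i; y \<in> Bs i\<rbrakk> \<Longrightarrow> x \<ominus> y \<in> Bs i"
  unfolding a_minus_def
  by (intro filt_add additive_subgroup.a_inv_closed[OF filt_subgroup])

lemma filt_antimono:
  assumes "1 \<le> i" "i \<le> j" shows "Bs j \<subseteq> Bs i"
  using assms(2)
proof (induction rule: dec_induct)
  case (step n)
  then show ?case using filt_Suc[of n] assms(1) by (meson le_trans subset_trans)
qed simp

lemma filt_mono: "\<lbrakk>x \<in> Bs j; 1 \<le> i; i \<le> j\<rbrakk> \<Longrightarrow> x \<in> Bs i"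
  using filt_antimono by blast

text \<open>The union of a descending chain is its first member, so an arbitrary element may be
  treated as one of degree at least 1.\<close>

lemma carrier_eq_filt_1: "carrier B = Bs 1"
  using filt_Un filt_antimono[OF order_refl] by blast

section \<open>Identities for \<open>\<star>\<close>: additivity on the right, defect on the
  left\<close>

lemma star_closed [simp, intro]: "\<lbrakk>a \<in> carrier B; b \<in> carrier B\<rbrakk> \<Longrightarrow> a \<star> b \<in> carrier B"
  by (simp add: star_def circ_closed)

lemma circ_eq_star:
  assumes a: "a \<in> carrier B" and b: "b \<in> carrier B"
  shows "a \<otimes> b = a \<star> b \<oplus> (a \<oplus> b)"
proof -
  have "\<ominus> a \<oplus> (\<ominus> b \<oplus> (a \<oplus> b)) = \<zero>"
    using l_neg[of "a \<oplus> b"] a b by (simp add: minus_add a_assoc)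
  then show ?thesis
    using a b by (simp add: star_def circ_closed a_minus_def a_assoc)
qed

lemma star_zero:
  assumes a: "a \<in> carrier B" shows "a \<star> \<zero> = \<zero>"
proof -
  \<comment> \<open>As \<open>\<zero>\<close> lies in \<open>Bs i\<close>, the product lies in
    \<open>Bs (1 + i)\<close>, hence in \<open>Bs i\<close>.\<close>
  have "a \<star> \<zero> \<in> Bs i" if "1 \<le> i" for i
    using star_filt[of 1 i a \<zero>] a that filt_zero carrier_eq_filt_1 filt_mono by fastforce
  then show ?thesis using filt_Int by auto
qed

lemma alpha_zero:
  assumes a: "a \<in> carrier B" shows "\<alpha> a = \<zero>"
proof -
  have "a \<otimes> \<zero> = a" using circ_eq_star[of a \<zero>] star_zero a by simp
  \<comment> \<open>This is the distributive law at \<open>b = c = \<zero>\<close>. The summand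
    \<open>\<zero>\<close> is kept so that \<open>a \<oplus> a\<close> can be cancelled on both
    sides.\<close>
  then have "a \<oplus> a \<oplus> \<zero> = a \<oplus> a \<oplus> \<alpha> a"
    using circ_add[of a \<zero> \<zero>] a by simp
  then show ?thesis using a alpha_closed by (simp del: r_zero)
qed

lemma star_add_right:
  assumes a: "a \<in> carrier B" and b: "b \<in> carrier B" and c: "c \<in> carrier B"
  shows "a \<star> (b \<oplus> c) = a \<star> b \<oplus> a \<star> c"
proof -
  have "a \<star> (b \<oplus> c) \<oplus> (a \<oplus> (b \<oplus> (c \<oplus> a))) = a \<star> b \<oplus> a \<star> c \<oplus> (a \<oplus> (b \<oplus> (c \<oplus> a)))"
    using circ_add[OF a b c] a b c by (simp add: circ_eq_star alpha_zero a_ac)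
  then show ?thesis using a b c by simp
qed

text \<open>Compare the two bracketings of \<open>a \<otimes> b \<otimes> c\<close>: right
  additivity expands \<open>a \<star> (b \<otimes> c)\<close>, and \<open>?k\<close> collects the
  summands that both sides share.\<close>

lemma star_circ:
  assumes a: "a \<in> carrier B" and b: "b \<in> carrier B" and c: "c \<in> carrier B"
  shows "(a \<otimes> b) \<star> c = a \<star> c \<oplus> b \<star> c \<oplus> a \<star> (b \<star> c)"
proof -
  let ?k = "a \<star> b \<oplus> (a \<oplus> (b \<oplus> c))"
  have "(a \<otimes> b) \<star> c \<oplus> ?k = (a \<otimes> b) \<otimes> c"
    using a b c by (simp add: circ_eq_star[of "a \<otimes> b"] circ_closed)
      (simp add: circ_eq_star a_ac)
  also have "\<dots> = a \<otimes> (b \<otimes> c)" using a b c by (rule circ_assoc)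
  also have "\<dots> = a \<star> c \<oplus> b \<star> c \<oplus> a \<star> (b \<star> c) \<oplus> ?k"
    using a b c by (simp add: circ_eq_star star_add_right a_ac)
  finally show ?thesis using a b c by (simp add: circ_closed)
qed

definition star_defect :: "'a \<Rightarrow> 'a \<Rightarrow> 'a \<Rightarrow> 'a"
  where "star_defect a b c = (a \<oplus> b) \<star> c \<ominus> (a \<star> c \<oplus> b \<star> c)"

lemma star_defect_closed [simp, intro]:
  "\<lbrakk>a \<in> carrier B; b \<in> carrier B; c \<in> carrier B\<rbrakk> \<Longrightarrow> star_defect a b c \<in> carrier B"
  by (simp add: star_defect_def)

lemma star_add_left:
  assumes "a \<in> carrier B" "b \<in> carrier B" "c \<in> carrier B"
  shows "(a \<oplus> b) \<star> c = a \<star> c \<oplus> b \<star> c \<oplus> star_defect a b c"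
proof -
  have "x = y \<oplus> (x \<ominus> y)" if "x \<in> carrier B" "y \<in> carrier B" for x y
    using that a_lcomm[of y x "\<ominus> y"] by (simp add: a_minus_def r_neg)
  then show ?thesis using assms by (simp add: star_defect_def)
qed

lemma star_defect_commute:
  "\<lbrakk>a \<in> carrier B; b \<in> carrier B; c \<in> carrier B\<rbrakk> \<Longrightarrow> star_defect a b c = star_defect b a c"
  by (simp add: star_defect_def a_comm)

text \<open>The identity has two uses: solved for \<open>star_defect a b c\<close> it drives the
  induction on degrees, and together with its copy for \<open>b\<close>, \<open>a\<close> it
  compares the two associators.\<close>

lemma star_star_defect:
  assumes a: "a \<in> carrier B" and b: "b \<in> carrier B" and c: "c \<in> carrier B"
  shows "a \<star> (b \<star> c) = star_defect a b c \<oplus> ((a \<star> b) \<star> c \<oplus> star_defect (a \<oplus> b) (a \<star> b) c)"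
proof -
  \<comment> \<open>With the product as last summand, the left factor splits first into
    \<open>a \<oplus> b\<close> and \<open>a \<star> b\<close>, then into \<open>a\<close> and
    \<open>b\<close>; each split contributes one defect.\<close>
  have "a \<otimes> b = a \<oplus> b \<oplus> a \<star> b" using a b by (simp add: circ_eq_star a_comm)
  then have "a \<star> c \<oplus> b \<star> c \<oplus> a \<star> (b \<star> c) = (a \<oplus> b \<oplus> a \<star> b) \<star> c"
    using star_circ[OF a b c] by simp
  also have "\<dots> = a \<star> c \<oplus> b \<star> c
      \<oplus> (star_defect a b c \<oplus> ((a \<star> b) \<star> c \<oplus> star_defect (a \<oplus> b) (a \<star> b) c))"
    using a b c by (simp add: star_add_left[of "a \<oplus> b"])
      (simp add: star_add_left[of a b] a_assoc)
  finally show ?thesis using a b c by simp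
qed

subsection \<open>Cosets and additivity modulo higher degree\<close>

lemma filt_coset_eq_iff:
  assumes n: "1 \<le> n" and x: "x \<in> carrier B" and y: "y \<in> carrier B"
  shows "Bs n +> x = Bs n +> y \<longleftrightarrow> x \<ominus> y \<in> Bs n"
proof -
  interpret abelian_subgroup "Bs n" B
    by (intro abelian_subgroupI3 filt_subgroup n abelian_group_axioms)
  have "x \<ominus> y \<in> Bs n \<longleftrightarrow> x \<in> Bs n +> y"
    using a_rcos_module[OF y x] by (simp add: a_minus_def)
  then show ?thesis
    using a_repr_independence'[OF _ y] a_rcos_self[OF x] by metis
qed

text \<open>The bound \<open>m\<close> is kept separate from \<open>i + j + k\<close> because it must stay fixed while \<open>i + j\<close> grows.\<close>

lemma star_defect_filt_le:
  assumes "1 \<le> i" "1 \<le> j" "1 \<le> k" "a \<in> Bs i" "b \<in> Bs j" "c \<in> Bs k"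
    and "1 \<le> m" "m \<le> i + j + k"
  shows "star_defect a b c \<in> Bs m"
  using assms
\<comment> \<open>The recursion raises \<open>i + j\<close>, so the measure drops as long as
  \<open>i + j < 2 * m\<close>. Once \<open>i + j\<close> reaches \<open>2 * m\<close>, one of
  \<open>i\<close>, \<open>j\<close> is at least \<open>m\<close> and \<open>absorb\<close>
  finishes.\<close>
proof (induction "2 * m - (i + j)" arbitrary: i j a b rule: less_induct)
  case less
  note carr = filt_carrier[OF less.prems(1,4)] filt_carrier[OF less.prems(2,5)]
    filt_carrier[OF less.prems(3,6)]
  interpret I: truss_ideal "Bs m" B using filt_ideal less.prems by simp
  \<comment> \<open>Here the circle operation passing to the quotient by \<open>Bs m\<close> enters:
    \<open>(x \<oplus> y) \<otimes> c\<close> and \<open>x \<otimes> c\<close> are congruent, and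
    they differ by the defect plus \<open>y \<star> c \<oplus> y\<close>, which lies in the
    ideal.\<close>
  have absorb: "star_defect x y c \<in> Bs m" if "x \<in> carrier B" "y \<in> Bs m" for x y
  proof -
    have y: "y \<in> carrier B" using that less.prems filt_carrier by blast
    have "Bs m +> (x \<oplus> y) = Bs m +> x"
      using that y less.prems
      by (simp add: filt_coset_eq_iff a_minus_def a_comm[of x y] a_assoc r_neg)
    then have "Bs m +> ((x \<oplus> y) \<otimes> c) = Bs m +> (x \<otimes> c)"
      using that y carr by (intro I.circ_quotient) auto
    moreover have "(x \<oplus> y) \<otimes> c \<ominus> x \<otimes> c = star_defect x y c \<oplus> (y \<star> c \<oplus> y)"
    proof -
      have "(x \<oplus> y) \<otimes> c = star_defect x y c \<oplus> (y \<star> c \<oplus> y) \<oplus> x \<otimes> c"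
        using that y carr by (simp add: circ_eq_star star_add_left a_ac)
      then show ?thesis
        using that y carr by (simp add: a_minus_def circ_closed a_assoc r_neg)
    qed
    ultimately have "star_defect x y c \<oplus> (y \<star> c \<oplus> y) \<in> Bs m"
      using that y carr less.prems by (simp add: filt_coset_eq_iff circ_closed)
    moreover have "y \<star> c \<oplus> y \<in> Bs m"
      using I.star_right that carr less.prems by (simp add: filt_add)
    ultimately have "star_defect x y c \<oplus> (y \<star> c \<oplus> y) \<ominus> (y \<star> c \<oplus> y) \<in> Bs m"
      using less.prems filt_minus by blast
    then show ?thesis
      using that y carr by (simp add: a_minus_def a_assoc r_neg)
  qed
  consider "m \<le> j" | "m \<le> i" | "i + j < 2 * m" by linarith
  then show ?case
  proof cases
    case 1
    then show ?thesis using absorb carr less.prems filt_mono by blast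
  next
    case 2
    then show ?thesis
      using absorb[of b a] carr less.prems filt_mono star_defect_commute by metis
  next
    case 3
    let ?l = "min i j"
    have "star_defect (a \<oplus> b) (a \<star> b) c \<in> Bs m"
    \<comment> \<open>\<open>a \<oplus> b\<close> only has degree \<open>min i j\<close>, but
      \<open>a \<star> b\<close> has degree \<open>i + j\<close>; as \<open>min i j\<close> is at
      least 1, the sum of the two indices grows strictly.\<close>
    proof (rule less.hyps[of ?l "i + j"])
      show "a \<oplus> b \<in> Bs ?l"
        using less.prems by (intro filt_add) (auto intro: filt_mono)
      show "a \<star> b \<in> Bs (i + j)" using less.prems star_filt by blast
    qed (use less.prems 3 in auto)
    moreover have "(a \<star> b) \<star> c \<in> Bs m" "a \<star> (b \<star> c) \<in> Bs m"
      using star_filt[OF _ _ star_filt[of i j a b], of k c]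
        star_filt[OF _ _ _ star_filt[of j k b c], of i a] less.prems
      by (auto intro: filt_mono simp: add.assoc)
    \<comment> \<open>By \<open>star_star_defect\<close> this difference is
      \<open>star_defect a b c\<close> itself.\<close>
    ultimately have "a \<star> (b \<star> c) \<ominus> ((a \<star> b) \<star> c \<oplus> star_defect (a \<oplus> b) (a \<star> b) c) \<in> Bs m"
      using less.prems by (simp add: filt_add filt_minus)
    then show ?thesis
      using carr by (simp add: star_star_defect a_minus_def a_assoc r_neg)
  qed
qed

lemma star_defect_filt:
  "\<lbrakk>1 \<le> i; 1 \<le> j; 1 \<le> k; a \<in> Bs i; b \<in> Bs j; c \<in> Bs k\<rbrakk> \<Longrightarrow> star_defect a b c \<in> Bs (i + j + k)"
  by (rule star_defect_filt_le[of i j k]) auto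

text \<open>With \<open>d = a \<ominus> a'\<close> and \<open>e = b \<ominus> b'\<close>, the two
  products differ by \<open>d \<star> b\<close>, \<open>a' \<star> e\<close> and a defect. The first
  two gain a degree from \<open>d\<close> and \<open>e\<close>; the defect of \<open>a'\<close>,
  \<open>d\<close>, \<open>b\<close> has degree at least \<open>i + Suc i + j\<close>.\<close>

lemma star_filt_coset_cong:
  assumes i: "1 \<le> i" and j: "1 \<le> j" and a: "a \<in> Bs i" "a' \<in> Bs i" and b: "b \<in> Bs j" "b' \<in> Bs j"
    and aa': "Bs (Suc i) +> a = Bs (Suc i) +> a'" and bb': "Bs (Suc j) +> b = Bs (Suc j) +> b'"
  shows "Bs (Suc (i + j)) +> a \<star> b = Bs (Suc (i + j)) +> a' \<star> b'"
proof -
  note carr = filt_carrier[OF i a(1)] filt_carrier[OF i a(2)] filt_carrier[OF j b(1)] filt_carrier[OF j b(2)]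
  define d e where "d = a \<ominus> a'" and "e = b \<ominus> b'"
  have d: "d \<in> Bs (Suc i)" and e: "e \<in> Bs (Suc j)"
    using aa' bb' carr by (simp_all add: d_def e_def filt_coset_eq_iff)
  then have dB: "d \<in> carrier B" "e \<in> carrier B" using filt_carrier[of "Suc i"] filt_carrier[of "Suc j"] by auto
  have ab: "a = a' \<oplus> d" "b = b' \<oplus> e"
    unfolding d_def e_def using carr a_lcomm[of a' a "\<ominus> a'"] a_lcomm[of b' b "\<ominus> b'"]
    by (simp_all add: a_minus_def r_neg)
  have d': "d \<in> Bs i" using d i by (rule filt_mono) simp
  let ?r = "d \<star> b \<oplus> star_defect a' d b \<oplus> a' \<star> e"
  have "a \<star> b = (a' \<oplus> d) \<star> b" using ab by simp
  also have "\<dots> = a' \<star> b \<oplus> d \<star> b \<oplus> star_defect a' d b"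
    using carr dB by (simp add: star_add_left)
  also have "a' \<star> b = a' \<star> b' \<oplus> a' \<star> e"
    using ab carr dB by (simp add: star_add_right)
  finally have "a \<star> b = ?r \<oplus> a' \<star> b'"
    using carr dB by (simp add: a_ac)
  then have "a \<star> b \<ominus> a' \<star> b' = ?r"
    using carr dB by (simp add: a_minus_def a_assoc r_neg)
  moreover have "d \<star> b \<in> Bs (Suc (i + j))" "a' \<star> e \<in> Bs (Suc (i + j))"
    using star_filt[of "Suc i" j d b] star_filt[of i "Suc j" a' e] i j a b d e by auto
  moreover have "star_defect a' d b \<in> Bs (Suc (i + j))"
    using star_defect_filt[OF i _ j a(2) d b(1)] i by (auto intro: filt_mono)
  ultimately show ?thesis
    using carr by (simp add: filt_coset_eq_iff filt_add)
qed

text \<open>The sides differ by \<open>star_defect a a' b\<close>, of degree at least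
  \<open>i + i + j\<close>, which exceeds \<open>i + j\<close> because \<open>i\<close> is
  positive.\<close>

lemma star_left_distrib_coset:
  assumes "1 \<le> i" "1 \<le> j" "a \<in> Bs i" "a' \<in> Bs i" "b \<in> Bs j"
  shows "Bs (Suc (i + j)) +> (a \<oplus> a') \<star> b = Bs (Suc (i + j)) +> (a \<star> b \<oplus> a' \<star> b)"
proof -
  have carr: "a \<in> carrier B" "a' \<in> carrier B" "b \<in> carrier B"
    using assms filt_carrier by blast+
  have "star_defect a a' b \<in> Bs (Suc (i + j))"
    using star_defect_filt[of i i j a a' b] assms by (auto intro: filt_mono)
  then show ?thesis
    using carr by (simp add: filt_coset_eq_iff flip: star_defect_def)
qed

text \<open>Expanding both sides by \<open>star_star_defect\<close> leaves the same terms, since the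
  defect of \<open>a\<close>, \<open>b\<close>, \<open>c\<close> is symmetric, except for the
  secondary defects \<open>?t\<close> and \<open>?s\<close>. Their degree is at least
  \<open>min i j + (i + j) + k\<close>, so they vanish modulo
  \<open>Bs (Suc (i + j + k))\<close>.\<close>

lemma star_associator_coset:
  assumes i: "1 \<le> i" and j: "1 \<le> j" and k: "1 \<le> k" and a: "a \<in> Bs i" and b: "b \<in> Bs j" and c: "c \<in> Bs k"
  shows "Bs (Suc (i + j + k)) +> ((a \<star> b) \<star> c \<oplus> b \<star> (a \<star> c))
       = Bs (Suc (i + j + k)) +> ((b \<star> a) \<star> c \<oplus> a \<star> (b \<star> c))"
proof -
  note carr = filt_carrier[OF i a] filt_carrier[OF j b] filt_carrier[OF k c]
  let ?u = "(a \<star> b) \<star> c \<oplus> b \<star> (a \<star> c)" and ?v = "(b \<star> a) \<star> c \<oplus> a \<star> (b \<star> c)"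
  let ?s = "star_defect (a \<oplus> b) (a \<star> b) c" and ?t = "star_defect (a \<oplus> b) (b \<star> a) c"
  let ?l = "min i j"
  have ab: "a \<oplus> b \<in> Bs ?l" using i j a b by (intro filt_add) (auto intro: filt_mono)
  have "star_defect (a \<oplus> b) x c \<in> Bs (Suc (i + j + k))" if "x \<in> Bs (i + j)" for x
    by (rule filt_mono[OF star_defect_filt[of ?l "i + j" k, OF _ _ k ab that c]]) (use i j in auto)
  then have st: "?s \<in> Bs (Suc (i + j + k))" "?t \<in> Bs (Suc (i + j + k))"
    using star_filt[OF i j a b] star_filt[OF j i b a] by (simp_all add: add.commute)
  have "star_defect b a c = star_defect a b c" "b \<oplus> a = a \<oplus> b"
    using carr by (simp_all add: star_defect_commute a_comm)
  then have "?v = star_defect a b c \<oplus> ((a \<star> b) \<star> c \<oplus> (?s \<oplus> (b \<star> a) \<star> c))"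
    and "?u = star_defect a b c \<oplus> ((a \<star> b) \<star> c \<oplus> (?t \<oplus> (b \<star> a) \<star> c))"
    using carr by (simp_all add: star_star_defect a_ac)
  then have "?u \<oplus> ?s = ?t \<oplus> ?v" using carr by (simp add: a_ac)
  then have "?u \<ominus> ?v = ?t \<ominus> ?s" using carr by (intro minus_eq_minusI) auto
  then show ?thesis using st carr by (simp add: filt_coset_eq_iff filt_minus)
qed

subsection \<open>Homogeneous components\<close>

abbreviation "gr \<equiv> gr_comp B Bs"

lemma gr_comm_group:
  assumes i: "1 \<le> i" shows "comm_group (gr i)"
proof -
  let ?G = "(add_monoid B)\<lparr>carrier := Bs i\<rparr>"
  have sub: "subgroup (Bs j) (add_monoid B)" if "1 \<le> j" for j
    using filt_subgroup[OF that] by (rule additive_subgroup.a_subgroup)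
  interpret G: group ?G
    by (rule subgroup.subgroup_is_group[OF sub[OF i] a_group])
  have "comm_group ?G"
    by (rule G.group_comm_groupI) (use i filt_carrier a_comm in auto)
  moreover have "subgroup (Bs (Suc i)) ?G"
    by (rule group.subgroup_incl[OF a_group sub sub]) (use i filt_Suc in auto)
  ultimately show ?thesis
    unfolding gr_comp_def by (rule comm_group.abelian_FactGroup)
qed

lemma gr_group: "1 \<le> i \<Longrightarrow> group (gr i)"
  using gr_comm_group comm_group.axioms(2) by blast

lemma gr_one: "\<one>\<^bsub>gr i\<^esub> = Bs (Suc i)"
  by (simp add: gr_comp_def)

text \<open>In this form the neutral element can be multiplied through representatives.\<close>

lemma gr_one_coset: "\<one>\<^bsub>gr i\<^esub> = Bs (Suc i) +> \<zero>"
  using filt_carrier[of "Suc i"] a_coset_add_zero[of "Bs (Suc i)"] by (simp add: gr_one subset_iff)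

lemma gr_carrier: "carrier (gr i) = (\<lambda>a. Bs (Suc i) +> a) ` Bs i"
  by (simp add: gr_comp_def carrier_FactGroup a_r_coset_def r_coset_def)

lemma gr_mult_coset:
  assumes "1 \<le> i" "a \<in> Bs i" "b \<in> Bs i"
  shows "(Bs (Suc i) +> a) \<otimes>\<^bsub>gr i\<^esub> (Bs (Suc i) +> b) = Bs (Suc i) +> (a \<oplus> b)"
proof -
  interpret abelian_subgroup "Bs (Suc i)" B
    by (intro abelian_subgroupI3 filt_subgroup abelian_group_axioms) simp
  have "(Bs (Suc i) +> a) \<otimes>\<^bsub>gr i\<^esub> (Bs (Suc i) +> b) = (Bs (Suc i) +> a) <+> (Bs (Suc i) +> b)"
    by (simp add: gr_comp_def set_add_def set_mult_def)
  then show ?thesis using assms filt_carrier a_rcos_sum by simp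
qed

text \<open>By \<open>star_filt_coset_cong\<close> all cosets in the union coincide, and the union
  is not empty because \<open>a\<close> and \<open>b\<close> lie in their own cosets.\<close>

lemma gr_hom_mult_coset:
  assumes i: "1 \<le> i" and j: "1 \<le> j" and a: "a \<in> Bs i" and b: "b \<in> Bs j"
  shows "gr_hom_mult B Bs i j (Bs (Suc i) +> a) (Bs (Suc j) +> b) = Bs (Suc (i + j)) +> a \<star> b"
proof -
  have self: "x \<in> Bs (Suc k) +> x" if "1 \<le> k" "x \<in> Bs k" for k x
    using abelian_subgroup.a_rcos_self[OF abelian_subgroupI3[OF filt_subgroup abelian_group_axioms]]
      that filt_carrier by simp
  have repr: "y \<in> Bs k \<and> Bs (Suc k) +> y = Bs (Suc k) +> x"
    if "1 \<le> k" "x \<in> Bs k" "y \<in> Bs (Suc k) +> x" for k x y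
  proof
    show "y \<in> Bs k"
      using that filt_Suc[of k] filt_add[of k] by (auto simp: a_r_coset_def r_coset_def)
    show "Bs (Suc k) +> y = Bs (Suc k) +> x"
      using abelian_subgroup.a_repr_independence'[OF abelian_subgroupI3[OF filt_subgroup abelian_group_axioms] that(3)]
        that filt_carrier by simp
  qed
  have "Bs (Suc (i + j)) +> x \<star> y = Bs (Suc (i + j)) +> a \<star> b"
    if "x \<in> Bs (Suc i) +> a" "y \<in> Bs (Suc j) +> b" for x y
    using star_filt_coset_cong[OF i j _ a _ b] repr[OF i a] repr[OF j b] that by blast
  then show ?thesis
    using self[OF i a] self[OF j b] unfolding gr_hom_mult_def by blast
qed

lemma gr_hom_mult_closed:
  assumes "1 \<le> i" "1 \<le> j" "P \<in> carrier (gr i)" "Q \<in> carrier (gr j)"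
  shows "gr_hom_mult B Bs i j P Q \<in> carrier (gr (i + j))"
  using assms by (auto simp: gr_carrier gr_hom_mult_coset intro!: imageI star_filt)

lemma gr_hom_mult_left_distrib:
  assumes "1 \<le> i" "1 \<le> j" "P \<in> carrier (gr i)" "P' \<in> carrier (gr i)" "Q \<in> carrier (gr j)"
  shows "gr_hom_mult B Bs i j (P \<otimes>\<^bsub>gr i\<^esub> P') Q
    = gr_hom_mult B Bs i j P Q \<otimes>\<^bsub>gr (i + j)\<^esub> gr_hom_mult B Bs i j P' Q"
  using assms
  by (auto simp: gr_carrier gr_hom_mult_coset gr_mult_coset filt_add star_filt star_left_distrib_coset)

lemma gr_hom_mult_right_distrib:
  assumes "1 \<le> i" "1 \<le> j" "P \<in> carrier (gr i)" "Q \<in> carrier (gr j)" "Q' \<in> carrier (gr j)"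
  shows "gr_hom_mult B Bs i j P (Q \<otimes>\<^bsub>gr j\<^esub> Q')
    = gr_hom_mult B Bs i j P Q \<otimes>\<^bsub>gr (i + j)\<^esub> gr_hom_mult B Bs i j P Q'"
  using assms filt_carrier
  by (auto simp: gr_carrier gr_hom_mult_coset gr_mult_coset filt_add star_filt star_add_right)

lemma gr_hom_mult_one_right:
  assumes "1 \<le> i" "1 \<le> j" "P \<in> carrier (gr i)"
  shows "gr_hom_mult B Bs i j P \<one>\<^bsub>gr j\<^esub> = \<one>\<^bsub>gr (i + j)\<^esub>"
  using assms filt_carrier
  by (auto simp: gr_carrier gr_one_coset gr_hom_mult_coset filt_zero star_zero)

text \<open>By left distributivity the product is an idempotent of the group
  \<open>gr (i + j)\<close>, hence its neutral element.\<close>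

lemma gr_hom_mult_one_left:
  assumes "1 \<le> i" "1 \<le> j" "Q \<in> carrier (gr j)"
  shows "gr_hom_mult B Bs i j \<one>\<^bsub>gr i\<^esub> Q = \<one>\<^bsub>gr (i + j)\<^esub>"
proof -
  interpret I: group "gr i" using assms gr_group by simp
  interpret N: group "gr (i + j)" using assms gr_group by simp
  have "gr_hom_mult B Bs i j \<one>\<^bsub>gr i\<^esub> Q \<otimes>\<^bsub>gr (i + j)\<^esub> gr_hom_mult B Bs i j \<one>\<^bsub>gr i\<^esub> Q
      = gr_hom_mult B Bs i j \<one>\<^bsub>gr i\<^esub> Q"
    using gr_hom_mult_left_distrib[of i j "\<one>\<^bsub>gr i\<^esub>" "\<one>\<^bsub>gr i\<^esub>" Q] assms by simp
  then show ?thesis using gr_hom_mult_closed assms N.r_cancel_one by simp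
qed

subsection \<open>The associated graded structure\<close>

abbreviation "L \<equiv> assoc_graded B Bs"

lemma L_carrier_iff: "x \<in> carrier L \<longleftrightarrow>
    x \<in> extensional {1..} \<and> (\<forall>n\<ge>1. x n \<in> carrier (gr n)) \<and> finite {n. 1 \<le> n \<and> x n \<noteq> \<one>\<^bsub>gr n\<^esub>}"
proof -
  have "carrier (sum_group {1..} gr)
      = {x \<in> \<Pi>\<^sub>E i\<in>{1..}. carrier (gr i). finite {i \<in> {1..}. x i \<noteq> \<one>\<^bsub>gr i\<^esub>}}"
    by (rule carrier_sum_group) (simp add: gr_group)
  then show ?thesis by (auto simp: assoc_graded_def PiE_iff)
qed

lemma L_comp: "\<lbrakk>x \<in> carrier L; 1 \<le> n\<rbrakk> \<Longrightarrow> x n \<in> carrier (gr n)"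
  by (simp add: L_carrier_iff)

lemma L_eqI:
  assumes "x \<in> carrier L" "y \<in> carrier L" "\<And>n. 1 \<le> n \<Longrightarrow> x n = y n" shows "x = y"
  using assms by (intro extensionalityI[of x "{1..}"]) (auto simp: L_carrier_iff)

lemma L_add_nth: "1 \<le> n \<Longrightarrow> (x \<oplus>\<^bsub>L\<^esub> y) n = x n \<otimes>\<^bsub>gr n\<^esub> y n"
  by (simp add: assoc_graded_def)

lemma L_mult_nth: "1 \<le> n \<Longrightarrow>
    (x \<otimes>\<^bsub>L\<^esub> y) n = finprod (gr n) (\<lambda>i. gr_hom_mult B Bs i (n - i) (x i) (y (n - i))) {1..<n}"
  by (simp add: assoc_graded_def gr_mult_def)

lemma L_mult_term_closed:
  assumes "x \<in> carrier L" "y \<in> carrier L" "i \<in> {1..<n}"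
  shows "gr_hom_mult B Bs i (n - i) (x i) (y (n - i)) \<in> carrier (gr n)"
  using gr_hom_mult_closed[of i "n - i" "x i" "y (n - i)"] assms L_comp by (simp add: Suc_le_eq)

sublocale L: abelian_group L
proof (rule comm_group_abelian_groupI)
  have "add_monoid L = sum_group {1..} gr" by (simp add: assoc_graded_def)
  moreover have carrier: "carrier (sum_group {1..} gr) = carrier L"
    by (simp add: assoc_graded_def)
  have "comm_group (sum_group {1..} gr)"
  proof (rule group.group_comm_groupI)
    show "group (sum_group {1..} gr)" by (rule sum_group) (simp add: gr_group)
    fix x y assume "x \<in> carrier (sum_group {1..} gr)" "y \<in> carrier (sum_group {1..} gr)"
    then show "x \<otimes>\<^bsub>sum_group {1..} gr\<^esub> y = y \<otimes>\<^bsub>sum_group {1..} gr\<^esub> x"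
      using comm_monoid.m_comm[OF comm_group.axioms(1)[OF gr_comm_group]]
      unfolding carrier by (auto simp: L_comp intro!: restrict_ext)
  qed
  ultimately show "comm_group (add_monoid L)" by simp
qed

lemma L_support_bounded:
  assumes "x \<in> carrier L"
  obtains N where "\<And>n. \<lbrakk>1 \<le> n; N < n\<rbrakk> \<Longrightarrow> x n = \<one>\<^bsub>gr n\<^esub>"
proof -
  have "finite {n. 1 \<le> n \<and> x n \<noteq> \<one>\<^bsub>gr n\<^esub>}" using assms by (simp add: L_carrier_iff)
  then obtain N where N: "\<forall>n\<in>{n. 1 \<le> n \<and> x n \<noteq> \<one>\<^bsub>gr n\<^esub>}. n \<le> N"
    unfolding finite_nat_set_iff_bounded_le by blast
  have "x n = \<one>\<^bsub>gr n\<^esub>" if "1 \<le> n" "N < n" for n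
    using bspec[OF N, of n] that by auto
  then show thesis by (rule that)
qed

lemma L_mult_closed [simp, intro]:
  assumes x: "x \<in> carrier L" and y: "y \<in> carrier L" shows "x \<otimes>\<^bsub>L\<^esub> y \<in> carrier L"
proof -
  have closed: "(x \<otimes>\<^bsub>L\<^esub> y) n \<in> carrier (gr n)" if n: "1 \<le> n" for n
  proof -
    interpret N: comm_group "gr n" using n by (rule gr_comm_group)
    show ?thesis using n L_mult_term_closed[OF x y] by (auto simp: L_mult_nth intro!: N.finprod_closed)
  qed
  obtain N where N: "\<And>n. 1 \<le> n \<Longrightarrow> N < n \<Longrightarrow> x n = \<one>\<^bsub>gr n\<^esub>"
    using L_support_bounded[OF x] by blast
  obtain M where M: "\<And>n. 1 \<le> n \<Longrightarrow> M < n \<Longrightarrow> y n = \<one>\<^bsub>gr n\<^esub>"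
    using L_support_bounded[OF y] by blast
  have "(x \<otimes>\<^bsub>L\<^esub> y) n = \<one>\<^bsub>gr n\<^esub>" if n: "1 \<le> n" "N + M < n" for n
  proof -
    interpret N: comm_group "gr n" using n by (intro gr_comm_group)
    \<comment> \<open>Beyond \<open>N + M\<close>, either \<open>i\<close> exceeds \<open>N\<close>
      or \<open>n - i\<close> exceeds \<open>M\<close>, so one factor is neutral.\<close>
    have "gr_hom_mult B Bs i (n - i) (x i) (y (n - i)) = \<one>\<^bsub>gr n\<^esub>" if "i \<in> {1..<n}" for i
    proof (cases "N < i")
      case True
      then show ?thesis
        using that N L_comp[OF y] gr_hom_mult_one_left[of i "n - i" "y (n - i)"] by (simp add: Suc_le_eq)
    next
      case False
      then have "y (n - i) = \<one>\<^bsub>gr (n - i)\<^esub>" using M that n by (simp add: Suc_le_eq)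
      then show ?thesis
        using that L_comp[OF x] gr_hom_mult_one_right[of i "n - i" "x i"] by (simp add: Suc_le_eq)
    qed
    then show ?thesis unfolding L_mult_nth[OF n(1)] by (rule N.finprod_one_eqI)
  qed
  then have "{n. 1 \<le> n \<and> (x \<otimes>\<^bsub>L\<^esub> y) n \<noteq> \<one>\<^bsub>gr n\<^esub>} \<subseteq> {..N + M}"
    by (auto simp del: One_nat_def intro: leI)
  moreover have "x \<otimes>\<^bsub>L\<^esub> y \<in> extensional {1..}"
    by (simp add: assoc_graded_def gr_mult_def)
  ultimately show ?thesis
    unfolding L_carrier_iff by (intro conjI allI impI closed finite_subset[OF _ finite_atMost])
qed

lemma L_left_distrib:
  assumes x: "x \<in> carrier L" and y: "y \<in> carrier L" and z: "z \<in> carrier L"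
  shows "(x \<oplus>\<^bsub>L\<^esub> y) \<otimes>\<^bsub>L\<^esub> z = x \<otimes>\<^bsub>L\<^esub> z \<oplus>\<^bsub>L\<^esub> y \<otimes>\<^bsub>L\<^esub> z"
proof (rule L_eqI)
  fix n :: nat assume n: "1 \<le> n"
  interpret N: comm_group "gr n" using n by (rule gr_comm_group)
  let ?t = "\<lambda>u i. gr_hom_mult B Bs i (n - i) (u i) (z (n - i))"
  have "?t (x \<oplus>\<^bsub>L\<^esub> y) i = ?t x i \<otimes>\<^bsub>gr n\<^esub> ?t y i" if "i \<in> {1..<n}" for i
    using that gr_hom_mult_left_distrib[of i "n - i"] x y z by (simp add: L_comp L_add_nth Suc_le_eq)
  then have "((x \<oplus>\<^bsub>L\<^esub> y) \<otimes>\<^bsub>L\<^esub> z) n = finprod (gr n) (\<lambda>i. ?t x i \<otimes>\<^bsub>gr n\<^esub> ?t y i) {1..<n}"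
    unfolding L_mult_nth[OF n]
    by (intro N.finprod_cong' refl funcsetI N.m_closed L_mult_term_closed x y z) auto
  then show "((x \<oplus>\<^bsub>L\<^esub> y) \<otimes>\<^bsub>L\<^esub> z) n = (x \<otimes>\<^bsub>L\<^esub> z \<oplus>\<^bsub>L\<^esub> y \<otimes>\<^bsub>L\<^esub> z) n"
    unfolding L_mult_nth[OF n] L_add_nth[OF n]
    using L_mult_term_closed[OF x z] L_mult_term_closed[OF y z] by (simp add: Pi_def)
qed (use assms in auto)

lemma L_right_distrib:
  assumes x: "x \<in> carrier L" and y: "y \<in> carrier L" and z: "z \<in> carrier L"
  shows "x \<otimes>\<^bsub>L\<^esub> (y \<oplus>\<^bsub>L\<^esub> z) = x \<otimes>\<^bsub>L\<^esub> y \<oplus>\<^bsub>L\<^esub> x \<otimes>\<^bsub>L\<^esub> z"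
proof (rule L_eqI)
  fix n :: nat assume n: "1 \<le> n"
  interpret N: comm_group "gr n" using n by (rule gr_comm_group)
  let ?t = "\<lambda>u i. gr_hom_mult B Bs i (n - i) (x i) (u (n - i))"
  have "?t (y \<oplus>\<^bsub>L\<^esub> z) i = ?t y i \<otimes>\<^bsub>gr n\<^esub> ?t z i" if "i \<in> {1..<n}" for i
    using that gr_hom_mult_right_distrib[of i "n - i"] x y z by (simp add: L_comp L_add_nth Suc_le_eq)
  then have "(x \<otimes>\<^bsub>L\<^esub> (y \<oplus>\<^bsub>L\<^esub> z)) n = finprod (gr n) (\<lambda>i. ?t y i \<otimes>\<^bsub>gr n\<^esub> ?t z i) {1..<n}"
    unfolding L_mult_nth[OF n]
    by (intro N.finprod_cong' refl funcsetI N.m_closed L_mult_term_closed x y z) auto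
  then show "(x \<otimes>\<^bsub>L\<^esub> (y \<oplus>\<^bsub>L\<^esub> z)) n = (x \<otimes>\<^bsub>L\<^esub> y \<oplus>\<^bsub>L\<^esub> x \<otimes>\<^bsub>L\<^esub> z) n"
    unfolding L_mult_nth[OF n] L_add_nth[OF n]
    using L_mult_term_closed[OF x y] L_mult_term_closed[OF x z] by (simp add: Pi_def)
qed (use assms in auto)

section \<open>Homogeneous elements and their generation of the graded structure\<close>

abbreviation homog :: "nat \<Rightarrow> 'a \<Rightarrow> nat \<Rightarrow> 'a set"
  where "homog i a \<equiv> gr_homog B Bs i (Bs (Suc i) +> a)"

lemma gr_homog_closed:
  assumes "1 \<le> i" "P \<in> carrier (gr i)" shows "gr_homog B Bs i P \<in> carrier L"
proof -
  have "{n. 1 \<le> n \<and> gr_homog B Bs i P n \<noteq> \<one>\<^bsub>gr n\<^esub>} \<subseteq> {i}"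
    by (auto simp: gr_homog_def)
  then show ?thesis
    using assms finite_subset[of _ "{i}"] group.is_monoid[OF gr_group]
    by (auto simp: L_carrier_iff gr_homog_def intro: monoid.one_closed)
qed

lemma homog_closed [simp, intro]: "\<lbrakk>1 \<le> i; a \<in> Bs i\<rbrakk> \<Longrightarrow> homog i a \<in> carrier L"
  by (rule gr_homog_closed) (auto simp: gr_carrier)

lemma homog_add:
  assumes "1 \<le> i" "a \<in> Bs i" "b \<in> Bs i" shows "homog i a \<oplus>\<^bsub>L\<^esub> homog i b = homog i (a \<oplus> b)"
proof (rule L_eqI)
  fix n :: nat assume "1 \<le> n"
  then show "(homog i a \<oplus>\<^bsub>L\<^esub> homog i b) n = homog i (a \<oplus> b) n"
    using assms group.is_monoid[OF gr_group]
    by (simp add: L_add_nth gr_homog_def gr_mult_coset monoid.one_closed monoid.l_one)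
qed (use assms filt_add in auto)

lemma homog_mult:
  assumes i: "1 \<le> i" and j: "1 \<le> j" and a: "a \<in> Bs i" and b: "b \<in> Bs j"
  shows "homog i a \<otimes>\<^bsub>L\<^esub> homog j b = homog (i + j) (a \<star> b)"
proof (rule L_eqI)
  let ?x = "homog i a" and ?y = "homog j b"
  have x: "?x \<in> carrier L" and y: "?y \<in> carrier L" using assms by auto
  fix n :: nat assume n: "1 \<le> n"
  interpret N: comm_group "gr n" using n by (rule gr_comm_group)
  let ?f = "\<lambda>k. gr_hom_mult B Bs k (n - k) (?x k) (?y (n - k))"
  \<comment> \<open>A term of the convolution survives only if both factors sit in their own
    degrees, that is \<open>k = i\<close> and \<open>n - k = j\<close>.\<close>
  have one: "?f k = \<one>\<^bsub>gr n\<^esub>" if k: "k \<in> {1..<n}" "k \<noteq> i \<or> n \<noteq> i + j" for k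
  proof (cases "k = i")
    case True
    then have "n - k \<noteq> j" using k by auto
    then have "?y (n - k) = \<one>\<^bsub>gr (n - k)\<^esub>" using k by (simp add: gr_homog_def Suc_le_eq)
    then show ?thesis
      using k L_comp[OF x] gr_hom_mult_one_right[of k "n - k" "?x k"] by (simp add: Suc_le_eq)
  next
    case False
    then have "?x k = \<one>\<^bsub>gr k\<^esub>" using k by (simp add: gr_homog_def)
    then show ?thesis
      using k L_comp[OF y] gr_hom_mult_one_left[of k "n - k" "?y (n - k)"] by (simp add: Suc_le_eq)
  qed
  show "(?x \<otimes>\<^bsub>L\<^esub> ?y) n = homog (i + j) (a \<star> b) n"
  proof (cases "n = i + j")
    case True
    have "(?x \<otimes>\<^bsub>L\<^esub> ?y) n = finprod (gr n) (\<lambda>k. if k = i then ?f k else \<one>\<^bsub>gr n\<^esub>) {1..<n}"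
      unfolding L_mult_nth[OF n] using one L_mult_term_closed[OF x y] by (intro N.finprod_cong') auto
    also have "\<dots> = ?f i"
      by (rule N.finprod_singleton_swap) (use True i j L_mult_term_closed[OF x y] in auto)
    also have "\<dots> = homog (i + j) (a \<star> b) n"
      using True assms gr_hom_mult_coset by (simp add: gr_homog_def)
    finally show ?thesis .
  next
    case False
    then have "(?x \<otimes>\<^bsub>L\<^esub> ?y) n = \<one>\<^bsub>gr n\<^esub>"
      unfolding L_mult_nth[OF n] using one by (intro N.finprod_one_eqI) blast
    then show ?thesis using n False by (simp add: gr_homog_def)
  qed
qed (use assms star_filt in auto)

text \<open>Homogeneous elements generate additively: splitting off one nontrivial component shrinks
  the finite support.\<close>

lemma L_induct [consumes 1, case_names homog add]:
  assumes x: "x \<in> carrier L"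
    and homog: "\<And>i a. \<lbrakk>1 \<le> i; a \<in> Bs i\<rbrakk> \<Longrightarrow> P (homog i a)"
    and add: "\<And>x y. \<lbrakk>x \<in> carrier L; y \<in> carrier L; P x; P y\<rbrakk> \<Longrightarrow> P (x \<oplus>\<^bsub>L\<^esub> y)"
  shows "P x"
  using x
proof (induction "card {n. 1 \<le> n \<and> x n \<noteq> \<one>\<^bsub>gr n\<^esub>}" arbitrary: x rule: less_induct)
  case less
  let ?S = "\<lambda>x. {n. 1 \<le> n \<and> x n \<noteq> \<one>\<^bsub>gr n\<^esub>}"
  show ?case
  proof (cases "?S x = {}")
    case True
    \<comment> \<open>The zero family counts as homogeneous of degree 1, which spares the rule a
      case for zero.\<close>
    have "x = homog 1 \<zero>"
    proof (rule L_eqI[OF less.prems homog_closed])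
      fix n :: nat assume "1 \<le> n"
      then show "x n = homog 1 \<zero> n" using True by (auto simp: gr_homog_def gr_one_coset)
    qed (simp_all add: filt_zero)
    moreover have "P (homog 1 \<zero>)" by (rule homog) (simp_all add: filt_zero)
    ultimately show ?thesis by simp
  next
    case False
    then obtain i where i: "i \<in> ?S x" by blast
    then obtain a where a: "a \<in> Bs i" "x i = Bs (Suc i) +> a"
      using L_comp[OF less.prems, of i] by (auto simp: gr_carrier)
    let ?y = "x(i := \<one>\<^bsub>gr i\<^esub>)"
    have S: "?S ?y = ?S x - {i}" by auto
    have fin: "finite (?S x)" using less.prems by (simp add: L_carrier_iff)
    have y: "?y \<in> carrier L"
      using less.prems i fin group.is_monoid[OF gr_group]
      unfolding L_carrier_iff S by (auto simp: extensional_def intro: monoid.one_closed)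
    have "card (?S ?y) < card (?S x)"
      unfolding S by (rule card_Diff1_less[OF fin i])
    then have "P ?y" using less.hyps y by blast
    moreover have "x = homog i a \<oplus>\<^bsub>L\<^esub> ?y"
    proof (rule L_eqI[OF less.prems])
      show "homog i a \<oplus>\<^bsub>L\<^esub> ?y \<in> carrier L" using y i a by auto
      fix n :: nat assume n: "1 \<le> n"
      then have "monoid (gr n)" by (intro group.is_monoid gr_group)
      then show "x n = (homog i a \<oplus>\<^bsub>L\<^esub> ?y) n"
        using n a(2) L_comp[OF less.prems n] unfolding L_add_nth[OF n]
        by (cases "n = i") (simp_all add: gr_homog_def monoid.l_one monoid.r_one)
    qed
    ultimately show ?thesis using add[of "homog i a" ?y] homog y i a by auto
  qed
qed

section \<open>The pre-Lie identity\<close>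

lemma L_associator_sym_homog:
  assumes i: "1 \<le> i" and j: "1 \<le> j" and k: "1 \<le> k" and a: "a \<in> Bs i" and b: "b \<in> Bs j" and c: "c \<in> Bs k"
  shows "(homog i a \<otimes>\<^bsub>L\<^esub> homog j b) \<otimes>\<^bsub>L\<^esub> homog k c \<oplus>\<^bsub>L\<^esub> homog j b \<otimes>\<^bsub>L\<^esub> (homog i a \<otimes>\<^bsub>L\<^esub> homog k c)
       = (homog j b \<otimes>\<^bsub>L\<^esub> homog i a) \<otimes>\<^bsub>L\<^esub> homog k c \<oplus>\<^bsub>L\<^esub> homog i a \<otimes>\<^bsub>L\<^esub> (homog j b \<otimes>\<^bsub>L\<^esub> homog k c)"
proof -
  have mem: "a \<star> b \<in> Bs (i + j)" "b \<star> a \<in> Bs (j + i)" "a \<star> c \<in> Bs (i + k)" "b \<star> c \<in> Bs (j + k)"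
    using assms star_filt by auto
  have mem': "(a \<star> b) \<star> c \<in> Bs (i + j + k)" "(b \<star> a) \<star> c \<in> Bs (i + j + k)"
    "a \<star> (b \<star> c) \<in> Bs (i + j + k)" "b \<star> (a \<star> c) \<in> Bs (i + j + k)"
    using star_filt[OF _ k mem(1) c] star_filt[OF _ k mem(2) c] star_filt[OF i _ a mem(4)]
      star_filt[OF j _ b mem(3)] i j by (simp_all add: ac_simps)
  \<comment> \<open>The triple products arise with differently arranged degrees;
    \<open>homog_add\<close> needs them in one and the same degree.\<close>
  have "homog (j + i + k) u = homog (i + j + k) u" "homog (j + (i + k)) u = homog (i + j + k) u"
    "homog (i + (j + k)) u = homog (i + j + k) u" for u
    by (simp_all add: ac_simps)
  then show ?thesis
    using assms mem mem' star_associator_coset[OF assms]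
    by (simp add: homog_mult homog_add)
qed

text \<open>Both sides are additive in each variable, so induction on \<open>x\<close>, then
  \<open>y\<close>, then \<open>z\<close> reduces the identity to homogeneous elements.\<close>

lemma L_associator_sym:
  assumes "x \<in> carrier L" "y \<in> carrier L" "z \<in> carrier L"
  shows "(x \<otimes>\<^bsub>L\<^esub> y) \<otimes>\<^bsub>L\<^esub> z \<oplus>\<^bsub>L\<^esub> y \<otimes>\<^bsub>L\<^esub> (x \<otimes>\<^bsub>L\<^esub> z) = (y \<otimes>\<^bsub>L\<^esub> x) \<otimes>\<^bsub>L\<^esub> z \<oplus>\<^bsub>L\<^esub> x \<otimes>\<^bsub>L\<^esub> (y \<otimes>\<^bsub>L\<^esub> z)"
proof -
  \<comment> \<open>Adds two instances of the identity, regrouped into the shape that the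
    distributive laws produce from a sum in one variable.\<close>
  have interchange: "(p \<oplus>\<^bsub>L\<^esub> p') \<oplus>\<^bsub>L\<^esub> (q \<oplus>\<^bsub>L\<^esub> q') = (r \<oplus>\<^bsub>L\<^esub> r') \<oplus>\<^bsub>L\<^esub> (s \<oplus>\<^bsub>L\<^esub> s')"
    if "p \<oplus>\<^bsub>L\<^esub> q = r \<oplus>\<^bsub>L\<^esub> s" "p' \<oplus>\<^bsub>L\<^esub> q' = r' \<oplus>\<^bsub>L\<^esub> s'"
      "p \<in> carrier L" "q \<in> carrier L" "r \<in> carrier L" "s \<in> carrier L"
      "p' \<in> carrier L" "q' \<in> carrier L" "r' \<in> carrier L" "s' \<in> carrier L" for p q r s p' q' r' s'
  proof -
    have "(p \<oplus>\<^bsub>L\<^esub> p') \<oplus>\<^bsub>L\<^esub> (q \<oplus>\<^bsub>L\<^esub> q') = (p \<oplus>\<^bsub>L\<^esub> q) \<oplus>\<^bsub>L\<^esub> (p' \<oplus>\<^bsub>L\<^esub> q')"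
      using that(3-) by (simp add: L.a_ac)
    also have "\<dots> = (r \<oplus>\<^bsub>L\<^esub> r') \<oplus>\<^bsub>L\<^esub> (s \<oplus>\<^bsub>L\<^esub> s')"
      unfolding that(1,2) using that(3-) by (simp add: L.a_ac)
    finally show ?thesis .
  qed
  from assms(1) show ?thesis
  proof (induction x rule: L_induct)
    case (homog i a)
    note ia = homog
    from assms(2) show ?case
    proof (induction y rule: L_induct)
      case (homog j b)
      note jb = homog
      from assms(3) show ?case
      proof (induction z rule: L_induct)
        case (homog k c)
        then show ?case using L_associator_sym_homog ia jb by blast
      next
        case (add u v)
        then show ?case
          using ia jb interchange[OF add.IH] by (simp add: L_right_distrib)
      qed
    next
      case (add u v)
      then show ?case
        using ia assms(3) interchange[OF add.IH] by (simp add: L_left_distrib L_right_distrib)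
    qed
  next
    case (add u v)
    then show ?case
      using assms interchange[OF add.IH] by (simp add: L_left_distrib L_right_distrib)
  qed
qed

lemma L_pre_lie: "pre_lie_algebra L"
proof
  fix x y z assume L: "x \<in> carrier L" "y \<in> carrier L" "z \<in> carrier L"
  then show "associator L x y z = associator L y x z"
    unfolding associator_def using L_associator_sym[OF L] by (intro L.minus_eq_minusI) auto
qed (use L_left_distrib L_right_distrib in auto)

end

theorem corollary6:
  fixes B :: "('a, 'm) ring_scheme"
    and \<alpha> :: "'a \<Rightarrow> 'a"
    and Bs :: "nat \<Rightarrow> 'a set"
  assumes "truss B \<alpha>"
    and "carrier B = (\<Union>i\<in>{1..}. Bs i)"
    and "\<And>i. 1 \<le> i \<Longrightarrow> truss_ideal (Bs i) B"
    and "\<And>i. 1 \<le> i \<Longrightarrow> Bs (Suc i) \<subseteq> Bs i"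
    and "\<And>i j a b. \<lbrakk>1 \<le> i; 1 \<le> j; a \<in> Bs i; b \<in> Bs j\<rbrakk> \<Longrightarrow> star B a b \<in> Bs (i + j)"
    and "(\<Inter>i\<in>{1..}. Bs i) = {\<zero>\<^bsub>B\<^esub>}"
    and "\<And>a. a \<in> carrier B \<Longrightarrow> 2 < filt_degree B Bs (\<alpha> a)"
  shows "(\<forall>i\<ge>1. \<forall>j\<ge>1. \<forall>a\<in>Bs i. \<forall>a'\<in>Bs i. \<forall>b\<in>Bs j. \<forall>b'\<in>Bs j.
            Bs (Suc i) +>\<^bsub>B\<^esub> a = Bs (Suc i) +>\<^bsub>B\<^esub> a' \<longrightarrow>
            Bs (Suc j) +>\<^bsub>B\<^esub> b = Bs (Suc j) +>\<^bsub>B\<^esub> b' \<longrightarrow>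
            Bs (Suc (i + j)) +>\<^bsub>B\<^esub> star B a b = Bs (Suc (i + j)) +>\<^bsub>B\<^esub> star B a' b')
       \<and> (\<forall>i\<ge>1. \<forall>j\<ge>1. \<forall>a\<in>Bs i. \<forall>b\<in>Bs j.
            gr_homog B Bs i (Bs (Suc i) +>\<^bsub>B\<^esub> a)
              \<otimes>\<^bsub>assoc_graded B Bs\<^esub> gr_homog B Bs j (Bs (Suc j) +>\<^bsub>B\<^esub> b)
            = gr_homog B Bs (i + j) (Bs (Suc (i + j)) +>\<^bsub>B\<^esub> star B a b))
       \<and> pre_lie_algebra (assoc_graded B Bs)"
proof -
  interpret filtered_truss B \<alpha> Bs
    by (intro filtered_truss.intro filtered_truss_axioms.intro) (fact assms)+
  show ?thesis
    by (intro conjI allI impI ballI L_pre_lie homog_mult) (rule star_filt_coset_cong)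
qed

end
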